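(* Let $p$ be a prime number and let $d$ be a positive integer. There exist positive integers $u, v$ such that $(du, dv, duv)$ is a solution for $p$ (that is, $\frac{4}{p} = \frac{1}{du} + \frac{1}{dv} + \frac{1}{duv}$ with $du \le dv \le duv$) if and only if there exists a positive integer $n$ such that $$p \equiv -4d \pmod{4dn-1}.$$ Moreover, for any such solution $(du, dv, duv)$ for $p$, $\gcd(u,v) = 1$.
   Context: For a positive integer $p$, a solution for $p$ is a triple $(x,y,z)$ of positive integers with $x \le y \le z$ and $\frac{4}{p} = \frac{1}{x} + \frac{1}{y} + \frac{1}{z}$. *)

theory Defs
  imports Complex_Main "HOL-Number_Theory.Cong"
begin

definition is_solution :: "nat \<Rightarrow> nat \<times> nat \<times> nat \<Rightarrow> bool" where
  "is_solution p = (\<lambda>(x, y, z). 0 < x \<and> x \<le> y \<and> y \<le> z \<and>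
     (4 / of_nat p :: rat) = 1 / of_nat x + 1 / of_nat y + 1 / of_nat z)"

end

theory Submission
  imports Defs
begin

text \<open>
  Clearing denominators, \<open>(du, dv, duv)\<close> is a solution iff \<open>u \<le> v\<close> and
  \<open>4duv = p(u + v + 1)\<close>. Since \<open>4uv > u + v + 1\<close>, the prime \<open>p\<close> does not divide \<open>d\<close>, so it divides
  \<open>u\<close> or \<open>v\<close> (for \<open>p = 2\<close>, because \<open>u + v + 1 = 2duv\<close> is even), by symmetry \<open>v = pn\<close>. Then \<open>4dun = u + pn + 1\<close>, which gives coprimality,
  and \<open>n\<close> divides \<open>u + 1\<close>, say \<open>u + 1 = nm\<close>, which leaves \<open>p + 4d = m(4dn - 1)\<close>. Conversely, this
  factorization of \<open>p + 4d\<close> yields \<open>u = nm - 1\<close> and \<open>v = pn\<close>.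
\<close>

lemma is_solution_iff:
  fixes p d u v :: nat
  assumes "p > 0" "d > 0" "u > 0" "v > 0"
  shows "is_solution p (d * u, d * v, d * u * v) \<longleftrightarrow>
    u \<le> v \<and> 4 * d * u * v = p * (u + v + 1)"
proof -
  have "(4 / of_nat p :: rat) = 1 / of_nat (d * u) + 1 / of_nat (d * v) + 1 / of_nat (d * u * v)
    \<longleftrightarrow> (of_nat (4 * d * u * v) :: rat) = of_nat (p * (u + v + 1))"
    using assms by (simp add: field_simps)
  then show ?thesis
    unfolding of_nat_eq_iff using assms by (simp add: is_solution_def)
qed

lemma prime_dvd_factor:
  fixes p d u v :: nat
  assumes "prime p" "d > 0" "u > 0" "v > 0" and eq: "4 * d * u * v = p * (u + v + 1)"
  shows "p dvd u \<or> p dvd v"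
proof -
  \<comment> \<open>Each of the three summands is at most \<open>u * v\<close>. If \<open>p\<close>
    divided \<open>d\<close>, cancelling \<open>p\<close> would make \<open>u + v + 1\<close> a
    positive multiple of \<open>4 * (u * v)\<close>, which is too large.\<close>
  have "u + v + 1 < 4 * (u * v)"
  proof -
    have "u \<le> u * v" "v \<le> u * v" "1 \<le> u * v"
      using assms by simp_all
    then show ?thesis by linarith
  qed
  have not_dvd_d: "\<not> p dvd d"
  proof
    assume "p dvd d"
    then obtain e where e: "d = p * e" ..
    have "p * (e * (4 * (u * v))) = p * (u + v + 1)"
      using eq by (simp add: e mult_ac)
    then have "e * (4 * (u * v)) = u + v + 1"
      using prime_gt_0_nat[OF \<open>prime p\<close>] by (simp only: mult_cancel1) simp
    moreover have "4 * (u * v) \<le> e * (4 * (u * v))"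
      using \<open>d > 0\<close> e by simp
    ultimately show False
      using \<open>u + v + 1 < 4 * (u * v)\<close> by linarith
  qed
  \<comment> \<open>Only an odd \<open>p\<close> is coprime to the factor 4, so 2 needs a parity
    argument: \<open>u + v\<close> is odd, so one of the two is even.\<close>
  show ?thesis
  proof (cases "p = 2")
    case True
    then have "u + v + 1 = 2 * (d * u * v)"
      using eq by simp
    then have "even (u + v + 1)" by simp
    then show ?thesis
      using True by auto
  next
    case False
    have "\<not> p dvd 4"
    proof
      assume "p dvd 4"
      then have "p dvd 2 ^ 2" by simp
      then have "p dvd 2"
        using \<open>prime p\<close> prime_dvd_power by blast
      with \<open>prime p\<close> False show False
        using primes_dvd_imp_eq two_is_prime_nat by blast
    qed
    moreover have "p dvd 4 * d * u * v"
      unfolding eq by simp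
    ultimately show ?thesis
      using \<open>prime p\<close> not_dvd_d by (simp add: prime_dvd_mult_iff)
  qed
qed

lemma cofactor_equation:
  fixes p d u n :: nat
  assumes "p > 0" and "4 * d * u * (p * n) = p * (u + p * n + 1)"
  shows "4 * d * u * n = u + p * n + 1"
proof -
  have "p * (4 * d * u * n) = p * (u + p * n + 1)"
    using assms(2) by (simp add: mult_ac)
  with \<open>p > 0\<close> show ?thesis by (simp only: mult_cancel1) simp
qed

text \<open>A common divisor of \<open>u\<close> and \<open>p * n\<close> divides both the left side
  and \<open>u + p * n\<close>, hence their difference 1.\<close>

lemma coprime_of_cofactor_equation:
  fixes p d u n :: nat
  assumes "4 * d * u * n = u + p * n + 1"
  shows "coprime u (p * n)"
proof (rule coprimeI)
  fix g assume g: "g dvd u" "g dvd p * n"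
  have "g dvd 4 * d * u * n"
    using g by simp
  then have "g dvd (u + p * n) + 1"
    using assms by simp
  then show "g dvd 1"
    using g dvd_add dvd_add_right_iff by blast
qed

lemma cong_of_cofactor_equation:
  fixes p d u n :: nat
  assumes eq: "4 * d * u * n = u + p * n + 1"
  shows "[int p = - 4 * int d] (mod (4 * int d * int n - 1))"
proof -
  have "n dvd p * n + (u + 1)"
    using eq by (metis add.assoc add.left_commute dvd_triv_right)
  then have "n dvd u + 1"
    using dvd_add_right_iff dvd_triv_right by blast
  then obtain m where m: "u + 1 = n * m" ..
  have "n > 0"
    using m by (cases n) auto
  have u: "int u = int n * int m - 1"
    using arg_cong[OF m, of int] by simp
  have "4 * int d * int u * int n = int u + int p * int n + 1"
    using arg_cong[OF eq, of int] by simp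
  \<comment> \<open>With \<open>u = n * m - 1\<close> the right side becomes
    \<open>n * (m + p)\<close>, so every term carries a factor \<open>n\<close>.\<close>
  then have "int n * (int p + 4 * int d) = int n * ((4 * int d * int n - 1) * int m)"
    unfolding u by (simp add: algebra_simps)
  then have "int p + 4 * int d = (4 * int d * int n - 1) * int m"
    using \<open>n > 0\<close> by simp
  then show ?thesis
    by (simp add: cong_iff_dvd_diff)
qed

text \<open>The witnesses are \<open>n * m - 1\<close> and \<open>p * n\<close>. Either may be the
  larger, so the order is left open here.\<close>

lemma solution_of_cong:
  fixes p d n :: nat
  assumes "p > 0" "d > 0" "n > 0"
    and "[int p = - 4 * int d] (mod (4 * int d * int n - 1))"
  shows "\<exists>u v :: nat. u > 0 \<and> v > 0 \<and> 4 * d * u * v = p * (u + v + 1)"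
proof -
  have "(4 * int d * int n - 1) dvd int p + 4 * int d"
    using assms(4) by (simp add: cong_iff_dvd_diff)
  then obtain m where m: "int p + 4 * int d = (4 * int d * int n - 1) * m" ..
  have "4 * int d * int n - 1 > 0"
  proof -
    have "int d * int n > 0"
      using assms by simp
    then show ?thesis by linarith
  qed
  moreover have "(4 * int d * int n - 1) * m > 0"
    using m assms by linarith
  ultimately have "m > 0"
    by (simp add: zero_less_mult_iff)
  define u where "u = int n * m - 1"
  \<comment> \<open>This identity also excludes \<open>u = 0\<close>, which \<open>n = m = 1\<close>
    would give: its left side is positive.\<close>
  have pm: "int p + m = 4 * int d * u"
    using m by (simp add: u_def algebra_simps)
  have "4 * int d * u > 0"
    using pm \<open>m > 0\<close> by linarith
  then have "u > 0"
    using \<open>d > 0\<close> by (simp add: zero_less_mult_iff)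
  have "4 * int d * u * (int p * int n) = (int p + m) * (int p * int n)"
    by (simp only: pm)
  \<comment> \<open>Here \<open>m * n\<close> is replaced by \<open>u + 1\<close>.\<close>
  also have "\<dots> = int p * (u + int p * int n + 1)"
    by (simp add: u_def algebra_simps)
  finally have "int (4 * d * nat u * (p * n)) = int (p * (nat u + p * n + 1))"
    using \<open>u > 0\<close> by (simp del: mult_cancel_left mult_cancel_right add: algebra_simps)
  then have "4 * d * nat u * (p * n) = p * (nat u + p * n + 1)"
    by (simp only: of_nat_eq_iff)
  moreover have "nat u > 0" "p * n > 0"
    using \<open>u > 0\<close> assms by simp_all
  ultimately show ?thesis by blast
qed

theorem mainTheorem1:
  fixes p d :: nat
  assumes "prime p" and "d > 0"
  shows "((\<exists>u v :: nat. u > 0 \<and> v > 0 \<and> is_solution p (d * u, d * v, d * u * v))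
            \<longleftrightarrow> (\<exists>n :: nat. n > 0 \<and>
                  [int p = - 4 * int d] (mod (4 * int d * int n - 1))))
         \<and> (\<forall>u v :: nat. u > 0 \<and> v > 0 \<and> is_solution p (d * u, d * v, d * u * v)
               \<longrightarrow> gcd u v = 1)"
proof -
  have "p > 0"
    using \<open>prime p\<close> by (rule prime_gt_0_nat)
  have sol: "gcd u v = 1 \<and>
      (\<exists>n :: nat. n > 0 \<and> [int p = - 4 * int d] (mod (4 * int d * int n - 1)))"
    if "u > 0" "v > 0" and eq: "4 * d * u * v = p * (u + v + 1)" for u v
  proof -
    \<comment> \<open>Here \<open>p * b\<close> is whichever of \<open>u\<close>, \<open>v\<close>
      is divisible by \<open>p\<close>, and \<open>a\<close> is the other; the gcd premise absorbs
      the swap.\<close>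
    have one_side: ?thesis
      if "a * p * b > 0" and ab: "4 * d * a * (p * b) = p * (a + p * b + 1)"
        and "gcd u v = gcd a (p * b)" for a b
    proof -
      note ab' = cofactor_equation[OF \<open>p > 0\<close> ab]
      have "b > 0"
        using that by simp
      with that(3) show ?thesis
        using coprime_of_cofactor_equation[OF ab'] cong_of_cofactor_equation[OF ab']
        by (auto simp: coprime_iff_gcd_eq_1)
    qed
    from prime_dvd_factor[OF assms \<open>u > 0\<close> \<open>v > 0\<close> eq] show ?thesis
    proof
      assume "p dvd u"
      then obtain b where "u = p * b" ..
      with \<open>u > 0\<close> \<open>v > 0\<close> eq show ?thesis
        by (intro one_side[of v b]) (simp_all add: algebra_simps gcd.commute)
    next
      assume "p dvd v"
      then obtain b where "v = p * b" ..
      with \<open>u > 0\<close> \<open>v > 0\<close> eq show ?thesis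
        by (intro one_side[of u b]) simp_all
    qed
  qed
  have "\<exists>u v :: nat. u > 0 \<and> v > 0 \<and> is_solution p (d * u, d * v, d * u * v)"
    if n: "n > 0" "[int p = - 4 * int d] (mod (4 * int d * int n - 1))" for n :: nat
  proof -
    obtain u v :: nat where uv: "u > 0" "v > 0" "4 * d * u * v = p * (u + v + 1)"
      using solution_of_cong[OF \<open>p > 0\<close> \<open>d > 0\<close> n] by blast
    \<comment> \<open>The equation is symmetric, so exchanging \<open>u\<close> and \<open>v\<close>
      restores the required order.\<close>
    have swapped: "4 * d * v * u = p * (v + u + 1)"
      using uv(3) by (simp add: mult_ac add_ac)
    show ?thesis
    proof (cases "u \<le> v")
      case True
      with uv show ?thesis
        using is_solution_iff[OF \<open>p > 0\<close> \<open>d > 0\<close> uv(1,2)] by blast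
    next
      case False
      then have "is_solution p (d * v, d * u, d * v * u)"
        using is_solution_iff[OF \<open>p > 0\<close> \<open>d > 0\<close> uv(2,1)] swapped by simp
      with uv show ?thesis by blast
    qed
  qed
  then show ?thesis
    using sol is_solution_iff[OF \<open>p > 0\<close> \<open>d > 0\<close>] by blast
qed

end
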